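(* Let $w, s, h, m_1, \ldots, m_s$ be positive integers with $w < h + m_1 + \cdots + m_s$, and let $I(w,s,h,m_1,\ldots,m_s;S,F)$ be a natural inglenook puzzle. Then: (i) if $w>1$, $s>1$, $h>1$ and \[ h-1+m_1+m_2+\cdots+m_s \geq w + \max\{h-1, m_1, m_2, \ldots, m_s\}, \qquad (\ast) \] the puzzle can always be solved; (ii) if $w>1$, $s>2$, $h=1$ and $(\ast)$ holds, the puzzle can always be solved; (iii) if $w=1$, the puzzle can always be solved; (iv) in all other cases, the puzzle cannot always be solved.
   Context: Inglenook puzzle: there are $s$ sidings of lengths $m_1,\ldots,m_s$, a headshunt of length $h$, and a set $W$ of $w$ wagons. A position is a tuple $(W_0,W_1,\ldots,W_s)$ of ordered subsets of $W$ (sequences without repetition) which partition $W$, with $|W_0|\le h$ and $|W_i|\le m_i$ for $1\le i\le s$. Here $W_0$ lists the wagons in the headshunt from shunting engine to points, and $W_i$ lists the wagons in Siding $i$ from points to buffer stop. A move is a pair of distinct positions $(W_0,\ldots,W_s)$, $(W_0',\ldots,W_s')$ such that for some $r\in\{1,\ldots,s\}$ we have $W_i=W_i'$ for all $i\in\{1,\ldots,s\}\setminus\{r\}$, and the concatenation of $W_0$ followed by $W_r$ equals the concatenation of $W_0'$ followed by $W_r'$. The inglenook graph $\Gamma(w,s,h,m_1,\ldots,m_s)$ is the undirected graph whose vertices are positions and whose edges are moves. The puzzle $I(w,s,h,m_1,\ldots,m_s;S,F)$ is specified by a set $S$ of starting positions and a set $F$ of finishing positions; it can always be solved if from every $p\in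 S$ there is a path in the inglenook graph to some position in $F$. The puzzle is natural if (1) $S$ is closed under permuting the wagons (applying any bijection $W\to W$ to the entries of a position in $S$ gives a position in $S$), and (2) there exist $z\in\{1,\ldots,s\}$ and a wagon $\omega\in W$ such that in every finishing position, $\omega$ is the last entry (the wagon nearest the buffer stop) of $W_z$.
   Formalization: The sets S of starting positions and F of finishing positions are assumed nonempty; with S empty the puzzle is vacuously solvable, contradicting (iv), and with F empty and S nonempty (i)–(iii) fail. *)

theory Defs
  imports Main "Graph_Theory.Pair_Digraph"
begin

text \<open>
  A position is a list of length \<open>s + 1\<close>: entry \<open>0\<close> is the headshunt, listed from the shunting
  engine to the points, and entry \<open>i\<close>, for \<open>1 \<le> i \<le> s\<close>, is Siding \<open>i\<close>, listed from the points to
  the buffer stop. Only the values \<open>m 1, \<dots>, m s\<close> of \<open>m\<close> matter. Distinctness of the concatenation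
  says both that no entry repeats a wagon and that different entries are disjoint.
\<close>

definition positions :: "'a set \<Rightarrow> nat \<Rightarrow> nat \<Rightarrow> (nat \<Rightarrow> nat) \<Rightarrow> 'a list list set" where
  "positions W s h m =
     {p. length p = s + 1 \<and> distinct (concat p) \<and> set (concat p) = W \<and>
         length (p ! 0) \<le> h \<and> (\<forall>i\<in>{1..s}. length (p ! i) \<le> m i)}"

definition moves :: "'a set \<Rightarrow> nat \<Rightarrow> nat \<Rightarrow> (nat \<Rightarrow> nat) \<Rightarrow> 'a list list rel" where
  "moves W s h m =
     {(p, q). p \<in> positions W s h m \<and> q \<in> positions W s h m \<and> p \<noteq> q \<and>
        (\<exists>r\<in>{1..s}. (\<forall>i\<in>{1..s} - {r}. p ! i = q ! i) \<and> p ! 0 @ p ! r = q ! 0 @ q ! r)}"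

text \<open>
  Undirected graphs are symmetric digraphs here; see the lemma below.
\<close>

definition inglenook_graph ::
    "'a set \<Rightarrow> nat \<Rightarrow> nat \<Rightarrow> (nat \<Rightarrow> nat) \<Rightarrow> 'a list list pair_pre_digraph" where
  "inglenook_graph W s h m = \<lparr> pverts = positions W s h m, parcs = moves W s h m \<rparr>"

lemma finite_positions:
  assumes "finite W"
  shows "finite (positions W s h m)"
proof -
  let ?L = "{xs. set xs \<subseteq> W \<and> length xs \<le> card W}"
  have "positions W s h m \<subseteq> {p. set p \<subseteq> ?L \<and> length p = s + 1}"
  proof
    fix p assume p: "p \<in> positions W s h m"
    have "set xs \<subseteq> W \<and> length xs \<le> card W" if "xs \<in> set p" for xs
    proof -
      have "distinct xs" and sub: "set xs \<subseteq> W"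
        using p that by (auto simp: positions_def distinct_concat_iff)
      then have "length xs = card (set xs)" by (simp add: distinct_card)
      also have "\<dots> \<le> card W" using assms sub by (rule card_mono)
      finally show ?thesis using sub by simp
    qed
    moreover have "length p = s + 1" using p by (simp add: positions_def)
    ultimately show "p \<in> {p. set p \<subseteq> ?L \<and> length p = s + 1}" by blast
  qed
  moreover have "finite {p. set p \<subseteq> ?L \<and> length p = s + 1}"
    by (intro finite_lists_length_eq finite_lists_length_le assms)
  ultimately show ?thesis by (rule finite_subset)
qed

lemma pair_graph_inglenook_graph:
  assumes "finite W"
  shows "pair_graph (inglenook_graph W s h m)"
proof -
  let ?G = "inglenook_graph W s h m"
  have sub: "parcs ?G \<subseteq> pverts ?G \<times> pverts ?G"
    by (auto simp: inglenook_graph_def moves_def)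
  have fin: "finite (pverts ?G)"
    by (simp add: inglenook_graph_def finite_positions assms)
  have fin': "finite (parcs ?G)"
    using sub fin by (meson finite_SigmaI finite_subset)
  have "(q, p) \<in> moves W s h m" if "(p, q) \<in> moves W s h m" for p q
  proof -
    from that obtain r where "r \<in> {1..s}" "\<forall>i\<in>{1..s} - {r}. q ! i = p ! i"
      "q ! 0 @ q ! r = p ! 0 @ p ! r"
      unfolding moves_def by force
    with that show ?thesis unfolding moves_def by blast
  qed
  then have "sym (parcs ?G)"
    by (auto simp: sym_def inglenook_graph_def)
  then have sym: "symmetric (with_proj ?G)"
    by (simp add: symmetric_def)
  show ?thesis
    using sub fin fin' sym
    by unfold_locales (auto simp: inglenook_graph_def moves_def)
qed

definition inglenook_puzzle ::
    "'a set \<Rightarrow> nat \<Rightarrow> nat \<Rightarrow> (nat \<Rightarrow> nat) \<Rightarrow> 'a list list set \<Rightarrow> 'a list list set \<Rightarrow> bool" where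
  "inglenook_puzzle W s h m S F \<longleftrightarrow> S \<subseteq> positions W s h m \<and> F \<subseteq> positions W s h m"

definition natural_inglenook_puzzle ::
    "'a set \<Rightarrow> nat \<Rightarrow> nat \<Rightarrow> (nat \<Rightarrow> nat) \<Rightarrow> 'a list list set \<Rightarrow> 'a list list set \<Rightarrow> bool" where
  "natural_inglenook_puzzle W s h m S F \<longleftrightarrow>
     inglenook_puzzle W s h m S F \<and>
     (\<forall>\<sigma>. bij_betw \<sigma> W W \<longrightarrow> (\<forall>p\<in>S. map (map \<sigma>) p \<in> S)) \<and>
     (\<exists>z\<in>{1..s}. \<exists>\<omega>\<in>W. \<forall>q\<in>F. q ! z \<noteq> [] \<and> last (q ! z) = \<omega>)"

definition always_solvable ::
    "'a set \<Rightarrow> nat \<Rightarrow> nat \<Rightarrow> (nat \<Rightarrow> nat) \<Rightarrow> 'a list list set \<Rightarrow> 'a list list set \<Rightarrow> bool" where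
  "always_solvable W s h m S F \<longleftrightarrow>
     (\<forall>p\<in>S. \<exists>q\<in>F. \<exists>es. pre_digraph.apath (with_proj (inglenook_graph W s h m)) p es q)"

text \<open>
  For use with \<open>h > 0\<close> only: otherwise \<open>h - 1\<close> truncates.
\<close>

definition space_condition :: "nat \<Rightarrow> nat \<Rightarrow> nat \<Rightarrow> (nat \<Rightarrow> nat) \<Rightarrow> bool" where
  "space_condition w s h m \<longleftrightarrow>
     h - 1 + (\<Sum>i=1..s. m i) \<ge> w + Max (insert (h - 1) (m ` {1..s}))"

end

theory Submission
  imports Defs "HOL-Combinatorics.Permutations"
begin

text \<open>
  If there is enough space, the inglenook graph is connected. Permuting wagons is a graph
  automorphism, so "exchanging \<open>x\<close> and \<open>y\<close> leads to a connected position" is an equivalence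
  relation on wagons that depends only on the connected component. With an empty headshunt,
  the wagons nearest the points in two different sidings can be exchanged; moving wagons between
  the heads of sidings, or pulling them into the headshunt when all other sidings are full, then
  shows that all wagons are equivalent. Hence all permutations of a position are connected to
  it, and single transfers make any two positions have the same shape.

  If there is too little space, some wagon is stuck: the first one in the headshunt if the
  sidings cannot hold all wagons, and the last one of the longest siding (read as the last one of
  the headshunt when that siding is empty) if this siding can only just be emptied, or not at all.
  With one siding, or two sidings and \<open>h = 1\<close>, the linear order of all wagons never changes.
  A stuck wagon rules out that some wagon reaches the buffer stop of Siding \<open>z\<close>, and
  relabelling makes that wagon \<open>\<omega>\<close>.
\<close>

text \<open>Only the terms at \<open>i\<close> and \<open>j\<close> change, and their total does
  not. With \<open>g\<close> = \<open>mset\<close> this keeps the stock of wagons intact when two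
  entries of a position are rewritten.\<close>

lemma sum_update2:
  fixes g :: "'b \<Rightarrow> 'c::comm_monoid_add"
  assumes "finite A" "i \<in> A" "j \<in> A" "i \<noteq> j"
    and "g x + g y = g (f i) + g (f j)"
  shows "(\<Sum>k\<in>A. g ((f(i := x, j := y)) k)) = (\<Sum>k\<in>A. g (f k))"
proof -
  have A: "A = insert i (insert j (A - {i, j}))" using assms by auto
  have "(\<Sum>k\<in>A. g ((f(i := x, j := y)) k))
      = g x + (g y + (\<Sum>k\<in>A - {i, j}. g ((f(i := x, j := y)) k)))"
    using assms by (subst A) simp
  also have "(\<Sum>k\<in>A - {i, j}. g ((f(i := x, j := y)) k)) = (\<Sum>k\<in>A - {i, j}. g (f k))"
    by (rule sum.cong) auto
  also have "g x + (g y + \<dots>) = g (f i) + (g (f j) + (\<Sum>k\<in>A - {i, j}. g (f k)))"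
    using assms(5) by (simp add: add.assoc[symmetric])
  also have "\<dots> = (\<Sum>k\<in>A. g (f k))"
    using assms by (subst (2) A) simp
  finally show ?thesis .
qed

subsection \<open>Shunting and swapping\<close>

locale inglenook =
  fixes W :: "'a set" and s h :: nat and m :: "nat \<Rightarrow> nat"
  assumes finite_W: "finite W"
begin

text \<open>
  Below, positions are handled as functions from \<open>nat\<close>, of which only the values at
  \<open>0, \<dots>, s\<close> matter.
\<close>

abbreviation tuple :: "(nat \<Rightarrow> 'a list) \<Rightarrow> 'a list list" where
  "tuple f \<equiv> map f [0..<Suc s]"

text \<open>A single multiset equation replaces distinctness and coverage. It is additive over the
  entries, so an update only has to balance the entries it touches.\<close>

definition valid :: "(nat \<Rightarrow> 'a list) \<Rightarrow> bool" where
  "valid f \<longleftrightarrow> (\<Sum>i\<le>s. mset (f i)) = mset_set W \<and> length (f 0) \<le> h \<and>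
     (\<forall>i\<in>{1..s}. length (f i) \<le> m i)"

definition conn :: "(nat \<Rightarrow> 'a list) \<Rightarrow> (nat \<Rightarrow> 'a list) \<Rightarrow> bool" where
  "conn f g \<longleftrightarrow> (tuple f, tuple g) \<in> (moves W s h m)\<^sup>*"

lemma mset_eq_mset_set_iff: "mset xs = mset_set W \<longleftrightarrow> distinct xs \<and> set xs = W"
proof
  assume eq: "mset xs = mset_set W"
  have "count (mset xs) x \<le> 1" for x by (simp add: eq count_mset_set')
  moreover have "set xs = W"
    using arg_cong[OF eq, of set_mset] finite_W by simp
  ultimately show "distinct xs \<and> set xs = W"
    by (metis One_nat_def count_mset_0_iff distinct_count_atmost_1 le_Suc_eq le_zero_eq)
qed (auto simp: mset_set_set)

lemma tuple_mem_positions: "tuple f \<in> positions W s h m \<longleftrightarrow> valid f"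
proof -
  have "mset (concat (tuple f)) = (\<Sum>i\<in>set [0..<Suc s]. mset (f i))"
    by (simp only: mset_concat map_map comp_def interv_sum_list_conv_sum_set_nat)
  also have "set [0..<Suc s] = {..s}" by auto
  finally have "(\<Sum>i\<le>s. mset (f i)) = mset_set W \<longleftrightarrow>
      distinct (concat (tuple f)) \<and> set (concat (tuple f)) = W"
    using mset_eq_mset_set_iff by metis
  then show ?thesis
    unfolding positions_def valid_def by (auto simp del: upt_Suc)
qed

lemma tuple_nth: "p \<in> positions W s h m \<Longrightarrow> tuple ((!) p) = p"
  using map_nth[of p] by (auto simp: positions_def simp del: upt_Suc)

lemma valid_nth: "p \<in> positions W s h m \<Longrightarrow> valid ((!) p)"
  using tuple_mem_positions[of "(!) p"] tuple_nth by simp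

lemma tuple_cong: "(\<And>i. i \<le> s \<Longrightarrow> f i = g i) \<Longrightarrow> tuple f = tuple g"
  by (auto simp del: upt_Suc)

lemma conn_refl: "conn f f"
  by (simp add: conn_def)

lemma conn_trans: "conn f g \<Longrightarrow> conn g k \<Longrightarrow> conn f k"
  unfolding conn_def by (rule rtrancl_trans)

lemma moves_sym: "sym (moves W s h m)"
proof -
  interpret pair_graph "inglenook_graph W s h m"
    using finite_W by (rule pair_graph_inglenook_graph)
  show ?thesis using pair_sym_arcs by (simp add: symmetric_def inglenook_graph_def)
qed

lemma conn_sym: "conn f g \<Longrightarrow> conn g f"
  unfolding conn_def using moves_sym sym_rtrancl by (metis symE)

lemma sum_length:
  assumes "valid f"
  shows "(\<Sum>i\<le>s. length (f i)) = card W"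
proof -
  have "size (\<Sum>i\<le>s. mset (f i)) = size (mset_set W)"
    using assms by (simp only: valid_def)
  then show ?thesis by simp
qed

lemma sum_length':
  assumes "valid f"
  shows "length (f 0) + (\<Sum>i\<in>{1..s}. length (f i)) = card W"
proof -
  have "{..s} = insert 0 {1..s}" by auto
  with sum_length[OF assms] show ?thesis by simp
qed

lemma valid_distinct:
  assumes "valid f"
  shows "i \<le> s \<Longrightarrow> distinct (f i)"
    and "i \<le> s \<Longrightarrow> j \<le> s \<Longrightarrow> i \<noteq> j \<Longrightarrow> set (f i) \<inter> set (f j) = {}"
    and "i \<le> s \<Longrightarrow> set (f i) \<subseteq> W"
    and "(\<Union>i\<le>s. set (f i)) = W"
proof -
  have p: "tuple f \<in> positions W s h m" using assms by (simp only: tuple_mem_positions)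
  have eq: "mset_set W = (\<Sum>i\<le>s. mset (f i))" using assms by (simp add: valid_def)
  show U: "(\<Union>i\<le>s. set (f i)) = W"
    using p unfolding positions_def by (auto simp del: upt_Suc simp: atLeast0LessThan lessThan_Suc_atMost)
  \<comment> \<open>A wagon in two entries would be counted twice, whereas \<open>mset_set W\<close>
    counts each wagon at most once.\<close>
  have cnt: "(\<Sum>i\<le>s. count (mset (f i)) x) \<le> 1" for x
  proof -
    have "(\<Sum>i\<le>s. count (mset (f i)) x) = count (mset_set W) x" by (simp only: eq count_sum)
    also have "\<dots> \<le> 1" by (simp add: count_mset_set')
    finally show ?thesis .
  qed
  show "distinct (f i)" if "i \<le> s"
    using p that unfolding positions_def by (auto simp del: upt_Suc simp: distinct_concat_iff)
  show "set (f i) \<inter> set (f j) = {}" if "i \<le> s" "j \<le> s" "i \<noteq> j"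
  proof (rule ccontr)
    assume "set (f i) \<inter> set (f j) \<noteq> {}"
    then obtain x where x: "x \<in> set (f i)" "x \<in> set (f j)" by auto
    then have "1 \<le> count (mset (f i)) x" "1 \<le> count (mset (f j)) x"
      by (simp_all add: Suc_le_eq count_greater_zero_iff del: count_mset)
    then have "1 + 1 \<le> count (mset (f i)) x + count (mset (f j)) x" by (rule add_mono)
    then have "2 \<le> (\<Sum>k\<in>{i, j}. count (mset (f k)) x)" using that(3) by simp
    also have "\<dots> \<le> (\<Sum>k\<le>s. count (mset (f k)) x)"
      using that by (intro sum_mono2) auto
    finally show False using cnt[of x] by simp
  qed
  show "set (f i) \<subseteq> W" if "i \<le> s" using U that by auto
qed

lemma valid_update2:
  assumes "valid f" "i \<le> s" "j \<le> s" "i \<noteq> j" "mset x + mset y = mset (f i) + mset (f j)"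
    and "length x \<le> (if i = 0 then h else m i)" "length y \<le> (if j = 0 then h else m j)"
  shows "valid (f(i := x, j := y))"
  using assms(1) sum_update2[of "{..s}" i j mset x y f] assms(2-) unfolding valid_def
  by (auto split: if_splits)

lemma valid_length: "valid f \<Longrightarrow> i \<in> {1..s} \<Longrightarrow> length (f i) \<le> m i"
  by (simp add: valid_def)

section \<open>Elementary shunting\<close>

lemma shunt:
  assumes "valid f" "r \<in> {1..s}" "a @ b = f 0 @ f r" "length a \<le> h" "length b \<le> m r"
  shows "valid (f(0 := a, r := b))" "conn f (f(0 := a, r := b))"
proof -
  let ?g = "f(0 := a, r := b)"
  show v: "valid ?g"
    using assms by (intro valid_update2) (auto simp flip: mset_append)
  have "tuple f ! 0 @ tuple f ! r = tuple ?g ! 0 @ tuple ?g ! r"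
    using assms by (auto simp del: upt_Suc)
  moreover have "\<forall>i\<in>{1..s} - {r}. tuple f ! i = tuple ?g ! i"
    by (auto simp del: upt_Suc)
  \<comment> \<open>A move joins distinct positions, so a cut that changes nothing has to be covered
    by the empty path.\<close>
  ultimately have "tuple f = tuple ?g \<or> (tuple f, tuple ?g) \<in> moves W s h m"
    using v assms(1,2) unfolding moves_def tuple_mem_positions[symmetric] by blast
  then show "conn f ?g" unfolding conn_def by (metis r_into_rtrancl rtrancl.rtrancl_refl)
qed

lemma pull:
  assumes "valid f" "r \<in> {1..s}" "f r = x # v" "length (f 0) < h"
  shows "valid (f(0 := f 0 @ [x], r := v))" "conn f (f(0 := f 0 @ [x], r := v))"
proof -
  have "length (f r) \<le> m r" using assms(1,2) by (rule valid_length)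
  then show "valid (f(0 := f 0 @ [x], r := v))" "conn f (f(0 := f 0 @ [x], r := v))"
    using assms by (intro shunt; simp)+
qed

lemma push:
  assumes "valid f" "r \<in> {1..s}" "f 0 = u @ [x]" "length (f r) < m r"
  shows "valid (f(0 := u, r := x # f r))" "conn f (f(0 := u, r := x # f r))"
proof -
  have "length (f 0) \<le> h" using assms by (simp add: valid_def)
  then show "valid (f(0 := u, r := x # f r))" "conn f (f(0 := u, r := x # f r))"
    using assms by (intro shunt; simp)+
qed

text \<open>The wagon passes through one free place at the points end of the headshunt; the wagons
  already standing there stay where they are.\<close>

lemma transfer:
  assumes "valid f" "i \<in> {1..s}" "j \<in> {1..s}" "i \<noteq> j" "f i = x # v" "length (f j) < m j"
    and "length (f 0) < h"
  shows "valid (f(i := v, j := x # f j))" "conn f (f(i := v, j := x # f j))"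
proof -
  let ?g = "f(0 := f 0 @ [x], i := v)"
  have g: "valid ?g" "conn f ?g" using pull[of f i x v] assms by auto
  have "valid (?g(0 := f 0, j := x # ?g j))" "conn ?g (?g(0 := f 0, j := x # ?g j))"
    using push[of ?g j "f 0" x] g assms by auto
  moreover have "?g(0 := f 0, j := x # ?g j) = f(i := v, j := x # f j)"
    using assms by auto
  ultimately show "valid (f(i := v, j := x # f j))" "conn f (f(i := v, j := x # f j))"
    using g conn_trans by auto
qed

section \<open>Relabelling the wagons\<close>

abbreviation act :: "('a \<Rightarrow> 'a) \<Rightarrow> (nat \<Rightarrow> 'a list) \<Rightarrow> nat \<Rightarrow> 'a list" where
  "act \<sigma> f \<equiv> (\<lambda>i. map \<sigma> (f i))"

lemma positions_map:
  assumes "\<sigma> permutes W" "p \<in> positions W s h m"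
  shows "map (map \<sigma>) p \<in> positions W s h m"
proof -
  have "inj \<sigma>" "\<sigma> ` W = W" using assms by (auto simp: permutes_inj permutes_image)
  then show ?thesis using assms(2) unfolding positions_def
    by (auto simp: map_concat[symmetric] distinct_map inj_on_subset[OF _ subset_UNIV]
        simp flip: set_map simp del: set_concat)
qed

text \<open>Moves are described by equations between entries and concatenations, which
  \<open>map\<close> preserves; injectivity of the relabelling keeps the two positions
  distinct.\<close>

lemma moves_map:
  assumes "\<sigma> permutes W" "(p, q) \<in> moves W s h m"
  shows "(map (map \<sigma>) p, map (map \<sigma>) q) \<in> moves W s h m"
proof -
  have inj: "inj (map (map \<sigma>))" using assms by (simp add: permutes_inj)
  from assms(2) obtain r where pq: "p \<in> positions W s h m" "q \<in> positions W s h m" "p \<noteq> q"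
    and r: "r \<in> {1..s}" "\<forall>i\<in>{1..s} - {r}. p ! i = q ! i" "p ! 0 @ p ! r = q ! 0 @ q ! r"
    unfolding moves_def by auto
  have len: "length p = s + 1" "length q = s + 1" using pq by (auto simp: positions_def)
  have "map (map \<sigma>) p \<noteq> map (map \<sigma>) q" using inj pq(3) by (metis injD)
  moreover have "\<forall>i\<in>{1..s} - {r}. map (map \<sigma>) p ! i = map (map \<sigma>) q ! i"
    using r(2) len by auto
  moreover have "map (map \<sigma>) p ! 0 @ map (map \<sigma>) p ! r = map (map \<sigma>) q ! 0 @ map (map \<sigma>) q ! r"
    using r len by (simp add: map_append[symmetric] del: map_append)
  ultimately show ?thesis
    using pq positions_map[OF assms(1)] r(1) unfolding moves_def by blast
qed

lemma rtrancl_moves_map: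
  assumes "\<sigma> permutes W" "(p, q) \<in> (moves W s h m)\<^sup>*"
  shows "(map (map \<sigma>) p, map (map \<sigma>) q) \<in> (moves W s h m)\<^sup>*"
  using assms(2) by induction (auto intro: rtrancl_into_rtrancl moves_map[OF assms(1)])

lemma conn_act: "\<sigma> permutes W \<Longrightarrow> conn f g \<Longrightarrow> conn (act \<sigma> f) (act \<sigma> g)"
  using rtrancl_moves_map[of \<sigma> "tuple f" "tuple g"]
  by (simp add: conn_def comp_def del: upt_Suc)

text \<open>The path from \<open>f\<close> to \<open>act \<tau> f\<close>, relabelled by
  \<open>\<sigma>\<close>, starts where the path from \<open>f\<close> to
  \<open>act \<sigma> f\<close> ends.\<close>

lemma conn_act_trans:
  assumes "\<sigma> permutes W" "conn f (act \<sigma> f)" "conn f (act \<tau> f)"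
  shows "conn f (act (\<sigma> \<circ> \<tau>) f)"
  using conn_trans[OF assms(2) conn_act[OF assms(1,3)]] by (simp add: comp_def)

section \<open>Exchanging two wagons\<close>

definition swappable :: "(nat \<Rightarrow> 'a list) \<Rightarrow> 'a \<Rightarrow> 'a \<Rightarrow> bool" where
  "swappable f x y \<longleftrightarrow> x \<in> W \<and> y \<in> W \<and> conn f (act (transpose x y) f)"

text \<open>Walk from \<open>f\<close> to \<open>g\<close>, make the exchange there, and return
  along the relabelled path. Exchanges may therefore be carried out at any convenient connected
  position.\<close>

lemma swappable_conn:
  assumes "conn f g" "swappable g x y"
  shows "swappable f x y"
proof -
  have "transpose x y permutes W" using assms by (simp add: swappable_def permutes_swap_id)
  then have "conn (act (transpose x y) f) (act (transpose x y) g)" using assms conn_act by blast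
  then show ?thesis using assms unfolding swappable_def by (meson conn_sym conn_trans)
qed

lemma swappable_refl: "x \<in> W \<Longrightarrow> swappable f x x"
  by (simp add: swappable_def conn_refl)

lemma swappable_sym: "swappable f x y \<Longrightarrow> swappable f y x"
  by (simp add: swappable_def transpose_commute)

text \<open>Conjugating the transposition of \<open>y\<close> and \<open>z\<close> by that of
  \<open>x\<close> and \<open>y\<close> gives the transposition of \<open>x\<close> and
  \<open>z\<close>; the identity needs \<open>z\<close> to differ from both \<open>x\<close> and
  \<open>y\<close>.\<close>

lemma swappable_trans:
  assumes "swappable f x y" "swappable f y z"
  shows "swappable f x z"
proof (cases "x = z \<or> y = z")
  case True
  then show ?thesis using assms by (auto simp: swappable_def conn_refl)
next
  case False
  have "transpose x y permutes W" "transpose y z permutes W"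
    using assms by (simp_all add: swappable_def permutes_swap_id)
  then have "conn f (act (transpose x y \<circ> transpose y z \<circ> transpose x y) f)"
    using assms by (intro conn_act_trans permutes_compose) (auto simp: swappable_def)
  then show ?thesis
    using assms False transpose_comp_triple[of x z y] by (simp add: swappable_def)
qed

text \<open>No wagon occurs twice, so relabelling by a transposition touches only the two places
  where \<open>x\<close> and \<open>y\<close> stand.\<close>

lemma swappableI:
  assumes "valid f" "i \<le> s" "j \<le> s" "i \<noteq> j" "f i = u @ x # v" "f j = u' @ y # v'"
    and "conn f (f(i := u @ y # v, j := u' @ x # v'))"
  shows "swappable f x y"
proof -
  note d = valid_distinct[OF assms(1)]
  have x: "x \<notin> set u" "x \<notin> set v" and y: "y \<notin> set u'" "y \<notin> set v'"
    using d(1)[of i] d(1)[of j] assms by auto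
  have xk: "x \<notin> set (f k)" if "k \<le> s" "k \<noteq> i" for k using d(2)[of i k] assms that by auto
  have yk: "y \<notin> set (f k)" if "k \<le> s" "k \<noteq> j" for k using d(2)[of j k] assms that by auto
  have fixed: "map (transpose x y) l = l" if "x \<notin> set l" "y \<notin> set l" for l
    using that by (auto intro!: map_idI simp: transpose_def)
  have "x \<in> W" "y \<in> W" using d(3)[of i] d(3)[of j] assms by auto
  moreover have "act (transpose x y) f k = (f(i := u @ y # v, j := u' @ x # v')) k" if "k \<le> s" for k
    using assms x y xk[of j] yk[of i] xk[of k] yk[of k] that by (auto simp: fixed)
  then have "tuple (act (transpose x y) f) = tuple (f(i := u @ y # v, j := u' @ x # v'))"
    by (rule tuple_cong)
  ultimately show ?thesis using assms(7) unfolding swappable_def conn_def by metis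
qed

text \<open>Four moves: pull \<open>y\<close>, park it in Siding \<open>i\<close>, push
  \<open>x\<close> into Siding \<open>j\<close>, and fetch \<open>y\<close> back.\<close>

lemma swap_headshunt_siding:
  assumes "valid f" "f 0 = u @ [x]" "length (f 0) < h"
    and "i \<in> {1..s}" "j \<in> {1..s}" "i \<noteq> j" "length (f i) < m i" "f j = y # v"
  shows "swappable f x y"
proof (rule swappableI[of f 0 j u x "[]" "[]" y v])
  have lj: "length (f j) \<le> m j" using assms(1,5) by (rule valid_length)
  define g1 where "g1 = f(0 := u @ [x, y], j := v)"
  have 1: "valid g1" "conn f g1" using pull[of f j y v] assms by (auto simp: g1_def)
  define g2 where "g2 = f(0 := u @ [x], j := v, i := y # f i)"
  have "g2 = g1(0 := u @ [x], i := y # g1 i)" using assms by (auto simp: g1_def g2_def)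
  then have 2: "valid g2" "conn g1 g2"
    using push[of g1 i "u @ [x]" y] 1 assms by (auto simp: g1_def)
  define g3 where "g3 = f(0 := u, j := x # v, i := y # f i)"
  have "g3 = g2(0 := u, j := x # g2 j)" using assms by (auto simp: g3_def g2_def)
  then have 3: "valid g3" "conn g2 g3"
    using push[of g2 j u x] 2 assms lj by (auto simp: g2_def)
  define g4 where "g4 = f(0 := u @ [y], j := x # v)"
  have "g4 = g3(0 := g3 0 @ [y], i := f i)" using assms by (auto simp: g3_def g4_def)
  then have 4: "valid g4" "conn g3 g4"
    using pull[of g3 i y "f i"] 3 assms by (auto simp: g3_def)
  have "conn f g4" using 1 2 3 4 conn_trans by blast
  then show "conn f (f(0 := u @ y # [], j := [] @ x # v))" by (simp add: g4_def)
qed (use assms in auto)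

text \<open>Three transfers, with Siding \<open>k\<close> as the spare place: \<open>x\<close> to
  \<open>k\<close>, \<open>y\<close> to \<open>i\<close>, \<open>x\<close> to \<open>j\<close>. One
  free place in the headshunt suffices.\<close>

lemma swap_heads:
  assumes "valid f" "length (f 0) < h"
    and "i \<in> {1..s}" "j \<in> {1..s}" "k \<in> {1..s}" "i \<noteq> j" "k \<noteq> i" "k \<noteq> j"
    and "f i = x # v" "f j = y # v'" "length (f k) < m k"
  shows "swappable f x y"
proof (rule swappableI[of f i j "[]" x v "[]" y v'])
  have l: "length (f i) \<le> m i" "length (f j) \<le> m j"
    using assms(1,3,4) valid_length by blast+
  define g1 where "g1 = f(i := v, k := x # f k)"
  have 1: "valid g1" "conn f g1" using transfer[of f i k x v] assms by (auto simp: g1_def)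
  define g2 where "g2 = f(i := y # v, j := v', k := x # f k)"
  have "g2 = g1(j := v', i := y # g1 i)" using assms by (auto simp: g1_def g2_def)
  then have 2: "valid g2" "conn g1 g2"
    using transfer[of g1 j i y v'] 1 assms l by (auto simp: g1_def)
  define g3 where "g3 = f(i := y # v, j := x # v')"
  have "g3 = g2(k := f k, j := x # g2 j)" using assms by (auto simp: g2_def g3_def)
  then have 3: "valid g3" "conn g2 g3"
    using transfer[of g2 k j x "f k"] 2 assms l by (auto simp: g2_def)
  have "conn f g3" using 1 2 3 conn_trans by blast
  then show "conn f (f(i := [] @ y # v, j := [] @ x # v'))" by (simp add: g3_def)
qed (use assms in auto)

end

subsection \<open>Connectedness\<close>

text \<open>The capacity assumptions spell out \<open>space_condition\<close>: the sidings can hold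
  all wagons, and with any one siding empty the wagons still fit while leaving a place free in the
  headshunt. \<open>h_or_s\<close> excludes two sidings with \<open>h = 1\<close>.\<close>

locale spacious_inglenook = inglenook W s h m
  for W :: "'a set" and s h :: nat and m :: "nat \<Rightarrow> nat" +
  assumes h_pos: "h > 0" and m_pos: "i \<in> {1..s} \<Longrightarrow> m i > 0"
    and two_sidings: "s \<ge> 2" and h_or_s: "h \<ge> 2 \<or> s \<ge> 3"
    and capacity: "card W \<le> (\<Sum>i=1..s. m i)"
    and capacity_without: "j \<in> {1..s} \<Longrightarrow> card W \<le> h - 1 + (\<Sum>i\<in>{1..s} - {j}. m i)"
begin

text \<open>If all other sidings were full, \<open>capacity_without\<close> would leave at most
  \<open>h - 1\<close> wagons for Siding \<open>i\<close>. Conversely, a siding with only full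
  neighbours is short enough for the headshunt, with a place to spare.\<close>

lemma ex_space_elsewhere:
  assumes "valid f" "f 0 = []" "i \<in> {1..s}" "h \<le> length (f i)"
  shows "\<exists>k\<in>{1..s} - {i}. length (f k) < m k"
proof (rule ccontr)
  assume "\<not> ?thesis"
  then have "(\<Sum>k\<in>{1..s} - {i}. m k) \<le> (\<Sum>k\<in>{1..s} - {i}. length (f k))"
    by (intro sum_mono) (auto simp: not_less)
  moreover have "card W = length (f i) + (\<Sum>k\<in>{1..s} - {i}. length (f k))"
    using sum_length'[OF assms(1)] assms(2,3) by (simp add: sum.remove)
  ultimately show False
    using capacity_without[OF assms(3)] assms(4) h_pos by linarith
qed

text \<open>For \<open>h \<ge> 2\<close> the headshunt can hold both wagons; for
  \<open>h = 1\<close> a third siding has to help.\<close>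

lemma heads_swappable:
  assumes f: "valid f" "f 0 = []"
    and ij: "i \<in> {1..s}" "j \<in> {1..s}" "i \<noteq> j" and "f i = x # v" "f j = y # v'"
  shows "swappable f x y"
proof (cases "h \<ge> 2")
  case True
  have lv: "length v < m i" using valid_length[OF f(1) ij(1)] assms(6) by simp
  \<comment> \<open>Pulling \<open>x\<close> also opens the place in Siding \<open>i\<close> where
    \<open>y\<close> can be parked.\<close>
  define g where "g = f(0 := [x], i := v)"
  have g: "valid g" "conn f g"
    using pull[of f i x v] assms h_pos by (auto simp: g_def)
  have "swappable g x y"
    using swap_headshunt_siding[of g "[]" x i j y v'] g ij assms True lv by (auto simp: g_def)
  then show ?thesis using swappable_conn g by blast
next
  case False
  then have h: "h = 1" and s: "s \<ge> 3" using h_pos h_or_s by auto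
  show ?thesis
  proof (cases "\<exists>k\<in>{1..s} - {i, j}. length (f k) < m k")
    case True
    then obtain k where "k \<in> {1..s}" "k \<noteq> i" "k \<noteq> j" "length (f k) < m k" by blast
    then show ?thesis using swap_heads[of f i j k x v y v'] assms h by auto
  next
    case full: False
    \<comment> \<open>As \<open>h = 1\<close>, the nonempty Siding \<open>i\<close> forces room in
      another siding, which can only be \<open>j\<close>; likewise with \<open>i\<close> and
      \<open>j\<close> interchanged.\<close>
    have space: "length (f i) < m i" "length (f j) < m j"
      using ex_space_elsewhere[OF f ij(1)] ex_space_elsewhere[OF f ij(2)] full h assms(6,7)
      by auto
    have "card {i, j} < card {1..s}" using s ij by simp
    then obtain k where k: "k \<in> {1..s}" "k \<noteq> i" "k \<noteq> j"
      using card_mono[of "{i, j}" "{1..s}"] by (metis finite.emptyI finite_insert insertCI not_less subsetI insertE)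
    have "m k \<le> length (f k)" using full k by (meson DiffI insertE not_less singletonD)
    then have "f k \<noteq> []" using m_pos[OF k(1)] by auto
    then obtain z u where z: "f k = z # u" by (cases "f k") auto
    \<comment> \<open>Siding \<open>j\<close> is the spare place for exchanging \<open>x\<close> and
      \<open>z\<close>, and Siding \<open>i\<close> the one for \<open>y\<close> and
      \<open>z\<close>.\<close>
    have "swappable f x z"
      using swap_heads[of f i k j x v z u] assms k z space h by auto
    moreover have "swappable f y z"
      using swap_heads[of f j k i y v' z u] assms k z space h by auto
    ultimately show ?thesis using swappable_sym swappable_trans by blast
  qed
qed

text \<open>Induction on the depth \<open>k\<close>, for all positions at once. If another siding
  has room, the head of Siding \<open>i\<close> goes there: the wagon sought comes one step nearer
  the points, and the two new heads are exchangeable. Otherwise the front of Siding \<open>i\<close>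
  is drawn into the headshunt.\<close>

lemma nth_swappable_hd:
  assumes "valid f" "f 0 = []" "i \<in> {1..s}" "k < length (f i)"
  shows "swappable f (f i ! k) (hd (f i))"
  using assms
proof (induction k arbitrary: f)
  case 0
  then have "hd (f i) \<in> W" using valid_distinct(3)[of f i] by force
  with 0 show ?case by (simp add: hd_conv_nth swappable_refl)
next
  case (Suc k)
  note f = Suc.prems(1,2) and i = Suc.prems(3)
  obtain x v where x: "f i = x # v" using Suc.prems(4) by (cases "f i") auto
  have lf: "length (f i) \<le> m i" using valid_length f(1) i by blast
  show ?case
  proof (cases "\<exists>j\<in>{1..s} - {i}. length (f j) < m j")
    case True
    then obtain j where j: "j \<in> {1..s}" "j \<noteq> i" "length (f j) < m j" by blast
    define g where "g = f(i := v, j := x # f j)"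
    have g: "valid g" "conn f g" using transfer[of f i j x v] j x f i h_pos by (auto simp: g_def)
    have g0: "g 0 = []" and gi: "g i = v" and gj: "g j = x # f j"
      using i j f(2) by (auto simp: g_def)
    have k: "k < length v" using Suc.prems(4) x by simp
    have "swappable g (v ! k) (hd v)" using Suc.IH[OF g(1) g0 i] gi k by simp
    moreover obtain y v' where "v = y # v'" using k by (cases v) auto
    then have "swappable g (hd v) x"
      using heads_swappable[OF g(1) g0 i j(1) j(2)[symmetric] _ gj] gi by simp
    ultimately have "swappable g (v ! k) x" using swappable_trans by blast
    then show ?thesis using swappable_conn[OF g(2)] x by simp
  next
    case full: False
    then have lh: "length (f i) < h" using ex_space_elsewhere[OF f i] by (meson not_less)
    have "\<exists>j\<in>{1..s}. j \<noteq> i"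
    proof (cases "i = 1")
      case True
      then show ?thesis using two_sidings by (intro bexI[of _ 2]) auto
    next
      case False
      then show ?thesis using two_sidings by (intro bexI[of _ 1]) auto
    qed
    then obtain j where j: "j \<in> {1..s}" "j \<noteq> i" by auto
    have "m j \<le> length (f j)" using full j by (meson DiffI not_less singletonD)
    then have "f j \<noteq> []" using m_pos[OF j(1)] by auto
    then obtain y v' where y: "f j = y # v'" by (cases "f j") auto
    \<comment> \<open>These are \<open>k + 2\<close> wagons, so that the one with index
      \<open>Suc k\<close> stands next to the points; by \<open>lh\<close> a headshunt place stays
      free.\<close>
    define g where "g = f(0 := take (Suc (Suc k)) (f i), i := drop (Suc (Suc k)) (f i))"
    have g: "valid g" "conn f g"
      using shunt[of f i "take (Suc (Suc k)) (f i)" "drop (Suc (Suc k)) (f i)"] f i lh lf Suc.prems(4)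
      by (auto simp: g_def)
    have "g 0 = take (Suc k) (f i) @ [f i ! Suc k]"
      using Suc.prems(4) i by (auto simp: g_def take_Suc_conv_app_nth)
    moreover have "length (g 0) < h" "length (g i) < m i" "g j = y # v'"
      using i j y Suc.prems(4) lh lf by (auto simp: g_def)
    ultimately have "swappable g (f i ! Suc k) y"
      using swap_headshunt_siding[OF g(1) _ _ i j(1) j(2)[symmetric]] by blast
    then have "swappable f (f i ! Suc k) y" using swappable_conn g by blast
    moreover have "swappable f y x" using heads_swappable[OF f j(1) i j(2) y x] .
    ultimately show ?thesis using swappable_trans x by simp
  qed
qed

text \<open>Each wagon is exchangeable with the head of its own siding, and heads of different
  sidings with each other.\<close>

lemma all_swappable:
  assumes "valid f" "f 0 = []" "x \<in> W" "y \<in> W"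
  shows "swappable f x y"
proof -
  have ex: "\<exists>i\<in>{1..s}. f i \<noteq> [] \<and> swappable f x (hd (f i))" if "x \<in> W" for x
  proof -
    have "x \<in> (\<Union>i\<le>s. set (f i))" using that by (simp only: valid_distinct(4)[OF assms(1)])
    then obtain i where i: "i \<le> s" "x \<in> set (f i)" by blast
    then have "i \<noteq> 0" using assms(2) by (cases i) auto
    then have "i \<in> {1..s}" using i by auto
    moreover obtain k where "k < length (f i)" "x = f i ! k" using i by (auto simp: in_set_conv_nth)
    ultimately show ?thesis using nth_swappable_hd[OF assms(1,2)] by (metis list.size(3) not_less_zero)
  qed
  obtain i where i: "i \<in> {1..s}" "f i \<noteq> []" "swappable f x (hd (f i))" using ex assms(3) by blast
  obtain j where j: "j \<in> {1..s}" "f j \<noteq> []" "swappable f y (hd (f j))" using ex assms(4) by blast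
  have "swappable f (hd (f i)) (hd (f j))"
  proof (cases "i = j")
    case True
    moreover have "hd (f i) \<in> W" using i(3) by (simp add: swappable_def)
    ultimately show ?thesis using swappable_refl by simp
  next
    case False
    then show ?thesis
      using heads_swappable[OF assms(1,2) i(1) j(1) _ hd_Cons_tl[OF i(2), symmetric] hd_Cons_tl[OF j(2), symmetric]]
      by simp
  qed
  then show ?thesis using i(3) j(3) swappable_sym swappable_trans by blast
qed

lemma conn_act_permutes:
  assumes "valid f" "f 0 = []" "\<sigma> permutes W"
  shows "conn f (act \<sigma> f)"
  using assms(3) finite_W
proof (induction rule: permutes_induct)
  case id
  then show ?case by (simp add: conn_refl)
next
  case (swap a b p)
  have "swappable f a b" using assms swap all_swappable by blast
  then show ?case
    using swap by (intro conn_act_trans permutes_swap_id) (auto simp: swappable_def)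
qed

section \<open>Adjusting the shape of a position\<close>

lemma clear_headshunt:
  assumes "valid f"
  shows "\<exists>g. valid g \<and> conn f g \<and> g 0 = []"
  using assms
proof (induction "length (f 0)" arbitrary: f)
  case 0
  then show ?case using conn_refl by auto
next
  case (Suc n)
  obtain u x where u: "f 0 = u @ [x]" using Suc.hyps(2) by (cases "f 0" rule: rev_cases) auto
  \<comment> \<open>While a wagon is in the headshunt, the sidings hold fewer than
    \<open>card W\<close> wagons, so by \<open>capacity\<close> not all are full.\<close>
  have "\<exists>r\<in>{1..s}. length (f r) < m r"
  proof (rule ccontr)
    assume "\<not> ?thesis"
    then have "(\<Sum>i=1..s. m i) \<le> (\<Sum>i=1..s. length (f i))"
      by (intro sum_mono) (auto simp: not_less)
    then show False using sum_length'[OF Suc.prems] capacity u by simp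
  qed
  then obtain r where r: "r \<in> {1..s}" "length (f r) < m r" by auto
  let ?g = "f(0 := u, r := x # f r)"
  have g: "valid ?g" "conn f ?g" using push Suc.prems r u by auto
  have "n = length (?g 0)" using Suc.hyps(2) u r by auto
  then show ?case using Suc.hyps(1)[OF _ g(1)] g(2) conn_trans by blast
qed

lemma reshape:
  assumes "valid f" "f 0 = []" "valid g" "g 0 = []"
  shows "\<exists>f'. valid f' \<and> conn f f' \<and> f' 0 = [] \<and> (\<forall>i\<in>{1..s}. length (f' i) = length (g i))"
  using assms(1,2)
\<comment> \<open>Truncated subtraction: the measure counts only the surplus in sidings that are
  longer than intended.\<close>
proof (induction "\<Sum>i=1..s. length (f i) - length (g i)" arbitrary: f rule: less_induct)
  case less
  have sums: "(\<Sum>i=1..s. length (f i)) = (\<Sum>i=1..s. length (g i))"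
    using sum_length'[OF assms(3)] sum_length'[OF less.prems(1)] less.prems(2) assms(4) by simp
  show ?case
  proof (cases "\<forall>i\<in>{1..s}. length (f i) \<le> length (g i)")
    case True
    have "length (f i) = length (g i)" if "i \<in> {1..s}" for i
      using sum_mono_inv[OF sums _ that] True by auto
    then show ?thesis using less.prems conn_refl by blast
  next
    case False
    then obtain i where i: "i \<in> {1..s}" "length (f i) > length (g i)" by (auto simp: not_le)
    have "\<exists>j\<in>{1..s}. length (f j) < length (g j)"
    proof (rule ccontr)
      assume "\<not> ?thesis"
      then have "length (g k) \<le> length (f k)" if "k \<in> {1..s}" for k
        using that by (meson not_le)
      then show False using sum_mono_inv[OF sums[symmetric] _ i(1)] i(2) by auto
    qed
    then obtain j where j: "j \<in> {1..s}" "length (f j) < length (g j)" by auto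
    have ij: "i \<noteq> j" using i j by auto
    obtain x v where x: "f i = x # v" using i(2) by (cases "f i") auto
    \<comment> \<open>The target \<open>g\<close> is valid, so a siding shorter than its target has
      room.\<close>
    have "length (f j) < m j" using j valid_length[OF assms(3) j(1)] by simp
    define f1 where "f1 = f(i := v, j := x # f j)"
    have f1: "valid f1" "conn f f1"
      using transfer[OF less.prems(1) i(1) j(1) ij x \<open>length (f j) < m j\<close>] less.prems(2) h_pos
      by (auto simp: f1_def)
    have "(\<Sum>k=1..s. length (f1 k) - length (g k)) < (\<Sum>k=1..s. length (f k) - length (g k))"
    proof (rule sum_strict_mono_ex1)
      show "\<forall>k\<in>{1..s}. length (f1 k) - length (g k) \<le> length (f k) - length (g k)"
        using x j by (auto simp: f1_def)
      show "\<exists>k\<in>{1..s}. length (f1 k) - length (g k) < length (f k) - length (g k)"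
        using x i ij by (intro bexI[of _ i]) (auto simp: f1_def)
    qed simp
    moreover have "f1 0 = []" using less.prems(2) i j by (auto simp: f1_def)
    ultimately show ?thesis using less.hyps[of f1] f1 conn_trans by blast
  qed
qed

text \<open>Matching the concatenations place by place gives the relabelling; equal entry lengths
  allow the result to be cut back into entries.\<close>

lemma same_shape_permutes:
  assumes "valid f" "valid g" "\<And>i. i \<le> s \<Longrightarrow> length (f i) = length (g i)"
  shows "\<exists>\<sigma>. \<sigma> permutes W \<and> tuple (act \<sigma> f) = tuple g"
proof -
  define xs where "xs = concat (tuple f)"
  define ys where "ys = concat (tuple g)"
  have pos: "tuple f \<in> positions W s h m" "tuple g \<in> positions W s h m"
    using assms by (simp_all only: tuple_mem_positions)
  have d: "distinct xs" "set xs = W" "distinct ys" "set ys = W"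
    using pos by (simp_all add: positions_def xs_def ys_def del: upt_Suc)
  then have len: "length xs = length ys" by (metis distinct_card)
  obtain e where e: "bij_betw e W W" "map e xs = ys"
  proof
    let ?e = "(!) ys \<circ> the_inv_into {..<length xs} ((!) xs)"
    have bx: "bij_betw ((!) xs) {..<length xs} W" and by': "bij_betw ((!) ys) {..<length xs} W"
      using d len by (auto intro!: bij_betw_nth)
    show "bij_betw ?e W W" using bij_betw_trans[OF bij_betw_the_inv_into[OF bx] by'] .
    show "map ?e xs = ys"
      using len bx by (intro nth_equalityI) (auto simp: bij_betw_def the_inv_into_f_f)
  qed
  \<comment> \<open>\<open>permutes\<close> demands the identity outside \<open>W\<close>.\<close>
  define \<sigma> where "\<sigma> = (\<lambda>x. if x \<in> W then e x else x)"
  have "bij_betw \<sigma> W W" using e(1) by (simp add: \<sigma>_def cong: bij_betw_cong)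
  then have "\<sigma> permutes W" by (intro bij_imp_permutes) (auto simp: \<sigma>_def)
  moreover have "map \<sigma> xs = ys" using e(2) d by (auto simp: \<sigma>_def)
  then have "concat (tuple (act \<sigma> f)) = concat (tuple g)"
    by (simp add: xs_def ys_def map_concat comp_def del: upt_Suc)
  then have "tuple (act \<sigma> f) = tuple g"
    using assms(3) by (intro concat_injective) (auto simp: set_zip simp del: upt_Suc)
  ultimately show ?thesis by blast
qed

text \<open>Both positions are brought to an empty headshunt and a common shape; what then separates
  them is a relabelling.\<close>

lemma conn_valid:
  assumes "valid f" "valid g"
  shows "conn f g"
proof -
  obtain f1 where f1: "valid f1" "conn f f1" "f1 0 = []" using clear_headshunt assms by blast
  obtain g1 where g1: "valid g1" "conn g g1" "g1 0 = []" using clear_headshunt assms by blast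
  obtain f2 where f2: "valid f2" "conn f1 f2" "f2 0 = []" "\<forall>i\<in>{1..s}. length (f2 i) = length (g1 i)"
    using reshape[OF f1(1,3) g1(1,3)] by blast
  have "length (f2 i) = length (g1 i)" if "i \<le> s" for i
    using that f2 g1 by (cases i) auto
  then obtain \<sigma> where "\<sigma> permutes W" "tuple (act \<sigma> f2) = tuple g1"
    using same_shape_permutes[OF f2(1) g1(1)] by blast
  then have "conn f2 g1"
    using conn_act_permutes[OF f2(1,3)] unfolding conn_def by metis
  then show ?thesis using f1(2) f2(2) g1(2) conn_sym conn_trans by blast
qed

end

subsection \<open>Obstructions\<close>

context inglenook
begin

section \<open>From graph paths to sequences of moves\<close>

lemma apath_iff_rtrancl:
  assumes "p \<in> positions W s h m"
  shows "(\<exists>es. pre_digraph.apath (with_proj (inglenook_graph W s h m)) p es q) \<longleftrightarrow>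
    (p, q) \<in> (moves W s h m)\<^sup>*"
proof -
  let ?G = "inglenook_graph W s h m"
  interpret pair_graph ?G
    using finite_W by (rule pair_graph_inglenook_graph)
  \<comment> \<open>Graph reachability uses the closure restricted to vertices; moves never leave
    the positions, so both closures agree from \<open>p\<close>.\<close>
  have "(p, q) \<in> rtrancl_on (positions W s h m) (moves W s h m)"
    if "(p, q) \<in> (moves W s h m)\<^sup>*"
    using that
  proof induction
    case (step y z)
    have "z \<in> positions W s h m" using step.hyps(2) by (simp add: moves_def)
    with step.IH step.hyps(2) show ?case by (rule rtrancl_on_into_rtrancl_on)
  qed (use assms in auto)
  moreover have "(p, q) \<in> (moves W s h m)\<^sup>*"
    if "(p, q) \<in> rtrancl_on (positions W s h m) (moves W s h m)"
    using that by induction auto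
  ultimately have "p \<rightarrow>\<^sup>*\<^bsub>with_proj ?G\<^esub> q \<longleftrightarrow> (p, q) \<in> (moves W s h m)\<^sup>*"
    unfolding reachable_def by (auto simp: inglenook_graph_def)
  then show ?thesis by (simp add: reachable_apath)
qed

lemma always_solvable_iff:
  assumes "S \<subseteq> positions W s h m"
  shows "always_solvable W s h m S F \<longleftrightarrow> (\<forall>p\<in>S. \<exists>q\<in>F. (p, q) \<in> (moves W s h m)\<^sup>*)"
  using assms apath_iff_rtrancl unfolding always_solvable_def by blast

text \<open>The stuck wagon \<open>\<omega>'\<close> need not be the prescribed
  \<open>\<omega>\<close>. Exchanging their names in \<open>p\<close> gives another start in
  \<open>S\<close>; a solution from there, with the names exchanged back, would be a path from
  \<open>p\<close> that brings \<open>\<omega>'\<close> to the buffer stop.\<close>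

lemma not_always_solvableI:
  assumes natural: "natural_inglenook_puzzle W s h m S F" and "S \<noteq> {}"
    and stuck: "\<And>p z. p \<in> positions W s h m \<Longrightarrow> z \<in> {1..s} \<Longrightarrow>
      \<exists>\<omega>\<in>W. \<forall>q. (p, q) \<in> (moves W s h m)\<^sup>* \<longrightarrow> q ! z \<noteq> [] \<longrightarrow> last (q ! z) \<noteq> \<omega>"
  shows "\<not> always_solvable W s h m S F"
proof
  assume solvable: "always_solvable W s h m S F"
  have SF: "S \<subseteq> positions W s h m" "F \<subseteq> positions W s h m"
    and closed: "\<And>\<sigma> p. bij_betw \<sigma> W W \<Longrightarrow> p \<in> S \<Longrightarrow> map (map \<sigma>) p \<in> S"
    using natural unfolding natural_inglenook_puzzle_def inglenook_puzzle_def by blast+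
  obtain z \<omega> where z: "z \<in> {1..s}" "\<omega> \<in> W" "\<forall>q\<in>F. q ! z \<noteq> [] \<and> last (q ! z) = \<omega>"
    using natural unfolding natural_inglenook_puzzle_def by blast
  obtain p where p: "p \<in> S" using \<open>S \<noteq> {}\<close> by blast
  obtain \<omega>' where \<omega>': "\<omega>' \<in> W"
    "\<And>q. (p, q) \<in> (moves W s h m)\<^sup>* \<Longrightarrow> q ! z \<noteq> [] \<Longrightarrow> last (q ! z) \<noteq> \<omega>'"
    using stuck[of p z] p SF(1) z(1) by blast
  define \<tau> where "\<tau> = transpose \<omega> \<omega>'"
  have \<tau>: "\<tau> permutes W" using z(2) \<omega>'(1) by (simp add: \<tau>_def permutes_swap_id)
  then have "map (map \<tau>) p \<in> S" using closed p by (simp add: permutes_imp_bij)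
  then obtain q where q: "q \<in> F" "(map (map \<tau>) p, q) \<in> (moves W s h m)\<^sup>*"
    using solvable always_solvable_iff[OF SF(1)] by blast
  have "\<tau> \<circ> \<tau> = id" by (simp add: \<tau>_def)
  then have "map (map \<tau>) (map (map \<tau>) p) = p" by simp
  then have "(p, map (map \<tau>) q) \<in> (moves W s h m)\<^sup>*"
    using rtrancl_moves_map[OF \<tau> q(2)] by simp
  moreover have "z < length q" using q(1) SF(2) z(1) by (auto simp: positions_def)
  then have "map (map \<tau>) q ! z \<noteq> []" "last (map (map \<tau>) q ! z) = \<omega>'"
    using z(3) q(1) by (auto simp: last_map \<tau>_def)
  ultimately show False using \<omega>'(2) by blast
qed

section \<open>Invariants and stuck wagons\<close>

lemma positions_rtrancl:
  assumes "p \<in> positions W s h m" "(p, q) \<in> (moves W s h m)\<^sup>*"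
  shows "q \<in> positions W s h m"
  using assms(2,1) by induction (auto simp: moves_def)

lemma invariant:
  assumes "(p, q) \<in> (moves W s h m)\<^sup>*"
    and "\<And>q q' r. q \<in> positions W s h m \<Longrightarrow> q' \<in> positions W s h m \<Longrightarrow> r \<in> {1..s} \<Longrightarrow>
      \<forall>i\<in>{1..s} - {r}. q ! i = q' ! i \<Longrightarrow> q ! 0 @ q ! r = q' ! 0 @ q' ! r \<Longrightarrow> I q = I q'"
  shows "I p = I q"
  using assms(1)
proof induction
  case (step y z)
  then obtain r where "y \<in> positions W s h m" "z \<in> positions W s h m" "r \<in> {1..s}"
    "\<forall>i\<in>{1..s} - {r}. y ! i = z ! i" "y ! 0 @ y ! r = z ! 0 @ z ! r"
    unfolding moves_def by blast
  then have "I y = I z" by (rule assms(2))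
  then show ?case using step.IH by simp
qed simp

text \<open>The headshunt is never empty, so the wagon next to the engine begins the concatenation
  that each move preserves. It never enters a siding.\<close>

lemma stuck_long_headshunt:
  assumes "(\<Sum>i=1..s. m i) < card W" "p \<in> positions W s h m" "z \<in> {1..s}"
  shows "\<exists>\<omega>\<in>W. \<forall>q. (p, q) \<in> (moves W s h m)\<^sup>* \<longrightarrow> q ! z \<noteq> [] \<longrightarrow> last (q ! z) \<noteq> \<omega>"
proof -
  have ne: "q ! 0 \<noteq> []" if "q \<in> positions W s h m" for q
  proof
    assume "q ! 0 = []"
    moreover have "(\<Sum>i=1..s. length (q ! i)) \<le> (\<Sum>i=1..s. m i)"
      using valid_length[OF valid_nth[OF that]] by (intro sum_mono) auto
    ultimately show False using sum_length'[OF valid_nth[OF that]] assms(1) by simp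
  qed
  have mem: "hd (q ! 0) \<in> set (q ! 0)" if "q \<in> positions W s h m" for q
    using ne[OF that] by simp
  have "hd (p ! 0) \<in> W"
    using mem[OF assms(2)] valid_distinct(3)[OF valid_nth[OF assms(2)], of 0] by auto
  moreover have "last (q ! z) \<noteq> hd (p ! 0)"
    if q: "(p, q) \<in> (moves W s h m)\<^sup>*" "q ! z \<noteq> []" for q
  proof -
    have pos: "q \<in> positions W s h m" using positions_rtrancl[OF assms(2) q(1)] .
    have "hd (p ! 0) = hd (q ! 0)"
      using q(1) by (rule invariant) (metis hd_append ne)
    moreover have "set (q ! 0) \<inter> set (q ! z) = {}"
      using valid_distinct(2)[OF valid_nth[OF pos], of 0 z] assms(3) by auto
    ultimately show ?thesis using mem[OF pos] q(2) last_in_set by fastforce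
  qed
  ultimately show ?thesis by blast
qed

text \<open>Emptying Siding \<open>j\<close>, if possible at all, fills all other places, and then
  no move at another siding changes anything. Hence the wagon farthest from the engine along the
  headshunt and Siding \<open>j\<close> stays the same.\<close>

lemma stuck_long_siding:
  assumes j: "j \<in> {1..s}" and cap: "h + (\<Sum>i\<in>{1..s} - {j}. m i) \<le> card W"
    and "h > 0" "card W > 1"
    and p: "p \<in> positions W s h m" and z: "z \<in> {1..s}"
  shows "\<exists>\<omega>\<in>W. \<forall>q. (p, q) \<in> (moves W s h m)\<^sup>* \<longrightarrow> q ! z \<noteq> [] \<longrightarrow> last (q ! z) \<noteq> \<omega>"
proof -
  define L where "L q = last (q ! 0 @ q ! j)" for q :: "'a list list"
  have full: "length (q ! 0) = h \<and> (\<forall>i\<in>{1..s} - {j}. length (q ! i) = m i)"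
    if q: "q \<in> positions W s h m" and e: "q ! j = []" for q
  proof -
    have v: "valid ((!) q)" using valid_nth[OF q] .
    have le: "(\<Sum>i\<in>{1..s} - {j}. length (q ! i)) \<le> (\<Sum>i\<in>{1..s} - {j}. m i)"
      using valid_length[OF v] by (intro sum_mono) auto
    have l0: "length (q ! 0) \<le> h" using v by (simp add: valid_def)
    have sum: "length (q ! 0) + (\<Sum>i\<in>{1..s} - {j}. length (q ! i)) = card W"
      using sum_length'[OF v] e j by (simp add: sum.remove)
    then have eq: "(\<Sum>i\<in>{1..s} - {j}. length (q ! i)) = (\<Sum>i\<in>{1..s} - {j}. m i)"
      using le l0 cap by linarith
    have "length (q ! i) = m i" if "i \<in> {1..s} - {j}" for i
      using sum_mono_inv[OF eq _ that] valid_length[OF v] by auto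
    moreover have "length (q ! 0) = h" using sum eq l0 cap by linarith
    ultimately show ?thesis by blast
  qed
  have inv: "L q = L q'"
    if q: "q \<in> positions W s h m" "q' \<in> positions W s h m" and r: "r \<in> {1..s}"
      and same: "\<forall>i\<in>{1..s} - {r}. q ! i = q' ! i" "q ! 0 @ q ! r = q' ! 0 @ q' ! r" for q q' r
  proof (cases "r = j \<or> q ! j \<noteq> []")
    case True
    \<comment> \<open>For \<open>r = j\<close> the preserved concatenation is the one in
      \<open>L\<close>; otherwise a nonempty Siding \<open>j\<close> is untouched and alone
      determines \<open>L\<close>.\<close>
    then show ?thesis using same j unfolding L_def by (metis DiffI last_appendR singletonD)
  next
    case False
    then have e: "q ! j = []" "q' ! j = []" and rj: "r \<in> {1..s} - {j}" using same j r by auto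
    have "length (q ! 0) = length (q' ! 0)" using full[OF q(1) e(1)] full[OF q(2) e(2)] by simp
    then show ?thesis using same(2) e by (simp add: L_def)
  qed
  \<comment> \<open>With Siding \<open>j\<close> empty the headshunt holds \<open>h > 0\<close>
    wagons, so \<open>last\<close> is never applied to an empty list.\<close>
  have mem: "L q \<in> set (q ! 0 @ q ! j) \<and> (q ! j \<noteq> [] \<longrightarrow> L q \<in> set (q ! j))"
    if "q \<in> positions W s h m" for q
    using full[OF that] \<open>h > 0\<close> unfolding L_def by (cases "q ! j = []") auto
  have inv': "L p = L q" if "(p, q) \<in> (moves W s h m)\<^sup>*" for q
    using that inv by (rule invariant)
  have LW: "L p \<in> W"
    using mem[OF p] valid_distinct(3)[OF valid_nth[OF p], of 0]
      valid_distinct(3)[OF valid_nth[OF p], of j] j by auto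
  show ?thesis
  \<comment> \<open>Only \<open>L p\<close> can end Siding \<open>j\<close>, so any other wagon is
    kept from there; \<open>L p\<close> itself is kept from all other sidings.\<close>
  proof (cases "z = j")
    case True
    obtain \<omega> where \<omega>: "\<omega> \<in> W" "\<omega> \<noteq> L p"
      using \<open>card W > 1\<close> by (metis card_1_singleton_iff card_le_Suc0_iff_eq finite_W LW not_less One_nat_def)
    have "last (q ! z) \<noteq> \<omega>" if "(p, q) \<in> (moves W s h m)\<^sup>*" "q ! z \<noteq> []" for q
      using inv'[OF that(1)] \<omega>(2) that(2) True by (auto simp: L_def)
    then show ?thesis using \<omega>(1) by blast
  next
    case False
    have "last (q ! z) \<noteq> L p" if q: "(p, q) \<in> (moves W s h m)\<^sup>*" "q ! z \<noteq> []" for q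
    proof -
      have pos: "q \<in> positions W s h m" using positions_rtrancl[OF p q(1)] .
      have "set (q ! 0) \<inter> set (q ! z) = {}" "set (q ! j) \<inter> set (q ! z) = {}"
        using valid_distinct(2)[OF valid_nth[OF pos]] z j False by auto
      then show ?thesis using mem[OF pos] inv'[OF q(1)] last_in_set[OF q(2)] by auto
    qed
    then show ?thesis using LW by blast
  qed
qed

text \<open>Every move preserves the one concatenation, whose last wagon alone can reach the buffer
  stop.\<close>

lemma stuck_one_siding:
  assumes "s = 1" "card W > 1" "p \<in> positions W s h m" "z \<in> {1..s}"
  shows "\<exists>\<omega>\<in>W. \<forall>q. (p, q) \<in> (moves W s h m)\<^sup>* \<longrightarrow> q ! z \<noteq> [] \<longrightarrow> last (q ! z) \<noteq> \<omega>"
proof -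
  have z: "z = 1" using assms(1,4) by simp
  obtain \<omega> where \<omega>: "\<omega> \<in> W" "\<omega> \<noteq> last (p ! 0 @ p ! 1)"
    using \<open>card W > 1\<close> by (metis card_le_Suc0_iff_eq finite_W not_less One_nat_def)
  have "last (q ! z) \<noteq> \<omega>" if q: "(p, q) \<in> (moves W s h m)\<^sup>*" "q ! z \<noteq> []" for q
  proof -
    have "p ! 0 @ p ! 1 = q ! 0 @ q ! 1"
      using q(1) by (rule invariant) (use assms(1) in auto)
    then show ?thesis using \<omega>(2) q(2) z by (auto simp del: append_is_Nil_conv)
  qed
  then show ?thesis using \<omega>(1) by blast
qed

text \<open>A headshunt with one place equals its own reversal, so the line made of Siding 1
  reversed, the headshunt and Siding 2 never changes. Each of its ends is the only wagon that can
  reach the buffer stop on its side.\<close>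

lemma stuck_two_sidings:
  assumes "s = 2" "h = 1" "card W > 1" "p \<in> positions W s h m" "z \<in> {1..s}"
  shows "\<exists>\<omega>\<in>W. \<forall>q. (p, q) \<in> (moves W s h m)\<^sup>* \<longrightarrow> q ! z \<noteq> [] \<longrightarrow> last (q ! z) \<noteq> \<omega>"
proof -
  define L where "L q = rev (q ! 1) @ q ! 0 @ q ! 2" for q :: "'a list list"
  have rev0: "rev (q ! 0) = q ! 0" if "q \<in> positions W s h m" for q
  proof -
    have "length (q ! 0) \<le> 1" using that assms(2) by (simp add: positions_def)
    then show ?thesis by (cases "q ! 0") auto
  qed
  have inv: "L q = L q'"
    if q: "q \<in> positions W s h m" "q' \<in> positions W s h m" and r: "r \<in> {1..s}"
      and same: "\<forall>i\<in>{1..s} - {r}. q ! i = q' ! i" "q ! 0 @ q ! r = q' ! 0 @ q' ! r" for q q' r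
  proof -
    have "r = 1 \<or> r = 2" using r assms(1) by auto
    then show ?thesis
    proof
      assume r: "r = 1"
      then have "rev (q ! 1) @ rev (q ! 0) = rev (q' ! 1) @ rev (q' ! 0)"
        using same(2) by (metis rev_append)
      moreover have "q ! 2 = q' ! 2" using same(1) r assms(1) by auto
      ultimately show ?thesis using q rev0 by (simp add: L_def flip: append_assoc)
    next
      assume r: "r = 2"
      then have "q ! 1 = q' ! 1" using same(1) assms(1) by auto
      then show ?thesis using same(2) r by (simp add: L_def)
    qed
  qed
  have inv': "L p = L q" if "(p, q) \<in> (moves W s h m)\<^sup>*" for q
    using that inv by (rule invariant)
  have "{..s} = {0, 1, 2}" using assms(1) by auto
  then have "mset (L p) = mset_set W"
    using valid_nth[OF assms(4)] by (simp add: valid_def L_def add.left_commute)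
  then have L: "distinct (L p)" "set (L p) = W" by (simp_all add: mset_eq_mset_set_iff)
  then have len: "length (L p) > 1" using assms(3) distinct_card by metis
  then have ne: "hd (L p) \<noteq> last (L p)"
    using L(1) by (cases "L p") (auto split: if_splits)
  have hd: "last (q ! 1) = hd (L p)" if "(p, q) \<in> (moves W s h m)\<^sup>*" "q ! 1 \<noteq> []" for q
    using inv'[OF that(1)] that(2) by (simp add: L_def hd_append hd_rev)
  have last: "last (q ! 2) = last (L p)" if "(p, q) \<in> (moves W s h m)\<^sup>*" "q ! 2 \<noteq> []" for q
    using inv'[OF that(1)] that(2) by (simp add: L_def)
  have W: "hd (L p) \<in> W" "last (L p) \<in> W" using L(2) len
    by (metis hd_in_set last_in_set length_greater_0_conv less_trans zero_less_one)+
  have "z = 1 \<or> z = 2" using assms(1,5) by auto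
  \<comment> \<open>The wagon kept from the buffer stop of Siding \<open>z\<close> is the opposite
    end of the line.\<close>
  then show ?thesis using hd last ne W by metis
qed

text \<open>A lone wagon can always be brought into the headshunt, and only one position has it
  there.\<close>

lemma single_wagon_conn:
  assumes "card W = 1" "h > 0" "valid f" "valid g"
  shows "conn f g"
proof -
  have headshunt: "\<exists>f'. valid f' \<and> conn f f' \<and> (\<forall>i\<in>{1..s}. f' i = [])" if f: "valid f" for f
  proof (cases "\<forall>i\<in>{1..s}. f i = []")
    case True
    then show ?thesis using f conn_refl by blast
  next
    case False
    then obtain i where i: "i \<in> {1..s}" "f i \<noteq> []" by blast
    then obtain x v where x: "f i = x # v" by (cases "f i") auto
    have "length (f 0) + (length (f i) + (\<Sum>k\<in>{1..s} - {i}. length (f k))) = 1"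
      using sum_length'[OF f] i(1) assms(1) by (simp add: sum.remove)
    then have e: "f 0 = []" "v = []" "(\<Sum>k\<in>{1..s} - {i}. length (f k)) = 0" using x by auto
    then have "f k = []" if "k \<in> {1..s}" "k \<noteq> i" for k using that by auto
    then show ?thesis
      using pull[OF f i(1) x] e assms(2) by (intro exI[of _ "f(0 := f 0 @ [x], i := v)"]) auto
  qed
  obtain f' where f': "valid f'" "conn f f'" "\<forall>i\<in>{1..s}. f' i = []" using headshunt assms(3) by blast
  obtain g' where g': "valid g'" "conn g g'" "\<forall>i\<in>{1..s}. g' i = []" using headshunt assms(4) by blast
  obtain \<omega> where \<omega>: "W = {\<omega>}" using assms(1) card_1_singletonE by blast
  have single: "k 0 = [\<omega>]" if "valid k" "\<forall>i\<in>{1..s}. k i = []" for k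
  proof -
    have "length (k 0) = 1" using sum_length'[OF that(1)] that(2) assms(1) by simp
    then show ?thesis using valid_distinct(3)[OF that(1), of 0] \<omega> by (cases "k 0") auto
  qed
  have "f' i = g' i" if "i \<le> s" for i
    using that single[of f'] single[of g'] f' g' by (cases i) auto
  then have "tuple f' = tuple g'" by (rule tuple_cong)
  then have "conn f' g'" using conn_refl[of f'] unfolding conn_def by metis
  then show ?thesis using f'(2) g'(2) conn_sym conn_trans by blast
qed

end

text \<open>Comparing with the maximum means comparing with each member: \<open>h - 1\<close>
  cancels against the headshunt term, and \<open>m j\<close> removes Siding \<open>j\<close> from
  the sum.\<close>

lemma space_condition_iff:
  "space_condition w s h m \<longleftrightarrow> w \<le> (\<Sum>i=1..s. m i) \<and>
     (\<forall>j\<in>{1..s}. w \<le> h - 1 + (\<Sum>i\<in>{1..s} - {j}. m i))"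
proof -
  let ?A = "insert (h - 1) (m ` {1..s})" and ?c = "h - 1 + (\<Sum>i=1..s. m i)"
  have "Max ?A \<in> ?A" by (rule Max_in) auto
  moreover have "a \<le> Max ?A" if "a \<in> ?A" for a using that by (intro Max_ge) auto
  ultimately have "space_condition w s h m \<longleftrightarrow> (\<forall>a\<in>?A. w + a \<le> ?c)"
    unfolding space_condition_def by (meson add_left_mono order_trans)
  also have "\<dots> \<longleftrightarrow> w \<le> (\<Sum>i=1..s. m i) \<and> (\<forall>j\<in>{1..s}. w + m j \<le> ?c)"
    by auto
  also have "(\<forall>j\<in>{1..s}. w + m j \<le> ?c) \<longleftrightarrow>
      (\<forall>j\<in>{1..s}. w \<le> h - 1 + (\<Sum>i\<in>{1..s} - {j}. m i))"
    by (intro ball_cong) (auto simp: sum.remove)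
  finally show ?thesis .
qed

text \<open>Without a start a puzzle is vacuously solvable, and without a finish no start can be
  solved; hence \<open>S\<close> and \<open>F\<close> are taken nonempty.\<close>

theorem theorem1:
  fixes W :: "'a set" and w s h :: nat and m :: "nat \<Rightarrow> nat" and S F :: "'a list list set"
  assumes "finite W" and "card W = w"
    and "w > 0" and "s > 0" and "h > 0" and "\<forall>i\<in>{1..s}. m i > 0"
    and "w < h + (\<Sum>i=1..s. m i)"
    and "natural_inglenook_puzzle W s h m S F"
    and "S \<noteq> {}" and "F \<noteq> {}"
  shows "(w > 1 \<and> s > 1 \<and> h > 1 \<and> space_condition w s h m \<longrightarrow> always_solvable W s h m S F) \<and>
    (w > 1 \<and> s > 2 \<and> h = 1 \<and> space_condition w s h m \<longrightarrow> always_solvable W s h m S F) \<and>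
    (w = 1 \<longrightarrow> always_solvable W s h m S F) \<and>
    (\<not> (w > 1 \<and> s > 1 \<and> h > 1 \<and> space_condition w s h m) \<and>
     \<not> (w > 1 \<and> s > 2 \<and> h = 1 \<and> space_condition w s h m) \<and>
     \<not> w = 1 \<longrightarrow> \<not> always_solvable W s h m S F)"
proof -
  interpret inglenook W s h m using assms(1) by unfold_locales
  have SF: "S \<subseteq> positions W s h m" "F \<subseteq> positions W s h m"
    using assms(8) by (simp_all add: natural_inglenook_puzzle_def inglenook_puzzle_def)
  have solvable: "always_solvable W s h m S F" if "\<And>f g. valid f \<Longrightarrow> valid g \<Longrightarrow> conn f g"
  proof -
    have "(p, q) \<in> (moves W s h m)\<^sup>*" if "p \<in> S" "q \<in> F" for p q
    proof -
      have p: "p \<in> positions W s h m" and q: "q \<in> positions W s h m" using that SF by auto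
      have "conn ((!) p) ((!) q)"
        using \<open>\<And>f g. valid f \<Longrightarrow> valid g \<Longrightarrow> conn f g\<close> valid_nth[OF p] valid_nth[OF q] by blast
      then show ?thesis unfolding conn_def tuple_nth[OF p] tuple_nth[OF q] .
    qed
    then show ?thesis using always_solvable_iff[OF SF(1)] assms(10) by blast
  qed
  have spacious: "always_solvable W s h m S F"
    if "s > 1 \<and> h > 1 \<or> s > 2 \<and> h = 1" "space_condition w s h m"
  proof -
    interpret spacious_inglenook W s h m
      using that assms(2,5,6) unfolding space_condition_iff by unfold_locales auto
    show ?thesis using solvable conn_valid by blast
  qed
  have single: "always_solvable W s h m S F" if "w = 1"
    using solvable single_wagon_conn assms(2,5) that by blast
  have stuck: "\<not> always_solvable W s h m S F"
    if w: "w > 1" and no_space: "\<not> (s > 1 \<and> h > 1 \<and> space_condition w s h m)"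
      "\<not> (s > 2 \<and> h = 1 \<and> space_condition w s h m)"
  proof (rule not_always_solvableI[OF assms(8,9)])
    fix p z assume pz: "p \<in> positions W s h m" "z \<in> {1..s}"
    have w': "card W > 1" using w assms(2) by simp
    \<comment> \<open>If there is enough space, \<open>h > 1\<close> leaves only
      \<open>s = 1\<close>, and \<open>h = 1\<close> leaves \<open>s = 1\<close> or
      \<open>s = 2\<close>.\<close>
    consider "s = 1" | "s = 2" "h = 1" | "\<not> space_condition w s h m"
      using no_space assms(4,5) by linarith
    then show "\<exists>\<omega>\<in>W. \<forall>q. (p, q) \<in> (moves W s h m)\<^sup>* \<longrightarrow> q ! z \<noteq> [] \<longrightarrow> last (q ! z) \<noteq> \<omega>"
    proof cases
      case 1
      then show ?thesis using stuck_one_siding w' pz by blast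
    next
      case 2
      then show ?thesis using stuck_two_sidings w' pz by blast
    next
      case 3
      \<comment> \<open>Either the sidings cannot hold all wagons, or some Siding \<open>j\<close>
        cannot be emptied with a headshunt place left free.\<close>
      then consider "(\<Sum>i=1..s. m i) < card W"
        | j where "j \<in> {1..s}" "h - 1 + (\<Sum>i\<in>{1..s} - {j}. m i) < card W"
        unfolding space_condition_iff using assms(2) by (meson not_le)
      then show ?thesis
      proof cases
        case 1
        then show ?thesis using stuck_long_headshunt pz by blast
      next
        case (2 j)
        then have "h + (\<Sum>i\<in>{1..s} - {j}. m i) \<le> card W" using assms(5) by linarith
        then show ?thesis using stuck_long_siding[OF 2(1)] assms(5) w' pz by blast
      qed
    qed
  qed
  have "w > 1" if "w \<noteq> 1" using that assms(3) by linarith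
  then show ?thesis using spacious single stuck by (intro conjI impI) blast+
qed

end
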